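(* Let $z^*_{0:T}\colon\Xi\to\mathcal Z_{0:T}$ be an optimal policy of the multistage stochastic optimization problem $$\inf_{z_{0:T}\lhd\mathcal F_{0:T}}\mathcal R_{\mathcal S_{1:T}}\bigl(Q(z_{0:T}(\cdot);\cdot)\bigr),$$ the infimum being over all adapted policies, and let $v^*=(v^*_t)_{t=0}^T$ be the process $$v^*_t(x_{1:t}):=\mathcal R_{\mathcal S_{t+1:T}}\Bigl(Q\bigl(z^*_{0:t}(x_{1:t}),z^*_{t+1:T}(x_{1:t},\cdot);x_{1:t},\cdot\bigr)\mid x_{1:t}\Bigr).$$ Then $v^*$ is an $\mathcal R$-martingale and the starting value $v^*_0$ is the solution (optimal value) of the optimization problem.
   Context: Spaces: $T\ge1$; $\Xi_t$, $t=1,\dots,T$, are Polish spaces; $\Xi=\Xi_{1:T}:=\Xi_1\times\dots\times\Xi_T$, elements $x_{1:T}=(x_1,\dots,x_T)$, $x_{1:t}=(x_1,\dots,x_t)$, $x_{1:0}$ the empty tuple; $P$ is a Borel probability measure on $\Xi$; $\mathcal F_t$ is the sigma algebra generated by $x\mapsto x_{1:t}$, $\mathcal F_0$ trivial; $P(\cdot\mid x_{1:t})$ is the regular conditional probability on $\Xi_{t+1}\times\dots\times\Xi_T$ given the first $t$ coordinates. Risk functionals: a distortion function is a nondecreasing $\sigma\colon[0,1)\to[0,\infty)$ with $\int_0^1\sigma(u)\,du=1$. For $\alpha\in[0,1)$, $\mathsf{AV@R}_{\alpha;P}(Y):=\inf_{c\in\mathbb R}\{c+\frac1{1-\alpha}\mathbb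 E_P(Y-c)_+\}$, and $$\mathcal R_{\sigma;P}(Y):=\sup\Big\{\mathbb E_P Y\zeta:\ \zeta\ge0,\ \mathbb E_P\zeta=1,\ \mathsf{AV@R}_{\alpha;P}(\zeta)\le\tfrac1{1-\alpha}\int_\alpha^1\sigma(u)\,du\ \text{ for all }\alpha\in(0,1)\Big\}.$$ $\mathcal S_1,\dots,\mathcal S_T$ are collections of distortion functions. The conditional risk measure is $\mathcal R_{\mathcal S_{t+1}}(Y\mid x_{1:t}):=\sup_{\sigma\in\mathcal S_{t+1}}\mathcal R_{\sigma;P(\cdot\mid x_{1:t})}(Y(x_{1:t},\cdot))$, and for $s<t$ the nested risk functional is $$\mathcal R_{\mathcal S_{s+1:t}}(Y\mid x_{1:s}):=\mathcal R_{\mathcal S_{s+1}}\bigl(\dots\mathcal R_{\mathcal S_{t-1}}\bigl(\mathcal R_{\mathcal S_t}(Y\mid x_{1:t-1})\mid x_{1:t-2}\bigr)\dots\mid x_{1:s}\bigr);$$ $\mathcal R_{\mathcal S_{T+1:T}}$ is the identity and $\mathcal R_{\mathcal S_{1:T}}(Y)$ is the case $s=0,t=T$. Random variables are assumed to be such that the risk functionals are well defined. Policies: $\mathcal Z_{0:T}=\mathcal Z_0\times\dots\times\mathcal Z_T$ is the set of decisions; a policy $z=(z_t)_{t=0}^T$, $z_t\colon\Xi\to\mathcal Z_t$, is adapted, written $z_{0:T}\lhd\mathcal F_{0:T}$, if each $z_t$ is $\mathcal F_t$-measurable, i.e. $z_t=z_t(x_{1:t})$. $Q\colon\mathcal Z_{0:T}\times\Xi_{1:T}\to\mathbb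 R\cup\{\infty\}$ is a lower semi-continuous cost function, written $Q(z;x)$. An optimal policy is an adapted policy attaining the infimum. A stochastic process $(v_t)_{t=0}^T$ is an $\mathcal R$-martingale if $v_t(x_{1:t})=\mathcal R_{\mathcal S_{t+1}}(v_{t+1}\mid x_{1:t})$ a.s. for every $t\in\{0,\dots,T-1\}$. *)

theory Defs
  imports "HOL-Probability.Probability"
begin

text \<open>
  The spaces \<open>\<Xi>\<^sub>1, \<dots>, \<Xi>\<^sub>T\<close> may all be different. They are given as a family \<open>X\<close> of abstract
  topologies on one carrier type, and likewise \<open>Z\<close> for the decision spaces. A tuple with
  coordinates \<open>s, \<dots>, t\<close> is an extensional function in the product over \<open>{s..t}\<close>; in particular
  \<open>x\<^sub>1\<^sub>:\<^sub>t\<close> is \<open>restrict x {1..t}\<close>, and the empty tuple is \<open>\<lambda>_. undefined\<close>.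
\<close>

definition polish_topology :: "'a topology \<Rightarrow> bool" where
  "polish_topology X \<longleftrightarrow> completely_metrizable_space X \<and>
     (\<exists>D. countable D \<and> D \<subseteq> topspace X \<and> X closure_of D = topspace X)"

definition borel_of :: "'a topology \<Rightarrow> 'a measure" where
  "borel_of X = sigma (topspace X) {U. openin X U}"

definition lsc_on :: "'a topology \<Rightarrow> ('a \<Rightarrow> ereal) \<Rightarrow> bool" where
  "lsc_on X f \<longleftrightarrow> (\<forall>c::real. openin X {p \<in> topspace X. ereal c < f p})"


subsection \<open>Distortion risk functionals\<close>

text \<open>Only the values on \<open>[0,1)\<close> are relevant. An integral equal to 1 entails integrability.\<close>

definition distortion_function :: "(real \<Rightarrow> real) \<Rightarrow> bool" where
  "distortion_function \<sigma> \<longleftrightarrow> mono_on {0..<1} \<sigma> \<and> (\<forall>u\<in>{0..<1}. 0 \<le> \<sigma> u) \<and>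
     (LINT u:{0..<1}|lborel. \<sigma> u) = 1"

text \<open>
  Expectation of an extended real random variable as the difference of the integrals of its positive
  and negative parts (\<^const>\<open>e2ennreal\<close> sends negative arguments to 0). It is meaningful under
  \<open>quasi_integrable\<close>, which excludes \<open>\<infinity> - \<infinity>\<close>.
\<close>

definition expect :: "'a measure \<Rightarrow> ('a \<Rightarrow> ereal) \<Rightarrow> ereal" where
  "expect M Y = enn2ereal (\<integral>\<^sup>+\<omega>. e2ennreal (Y \<omega>) \<partial>M) - enn2ereal (\<integral>\<^sup>+\<omega>. e2ennreal (- Y \<omega>) \<partial>M)"

definition quasi_integrable :: "'a measure \<Rightarrow> ('a \<Rightarrow> ereal) \<Rightarrow> bool" where
  "quasi_integrable M Y \<longleftrightarrow> Y \<in> borel_measurable M \<and>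
     ((\<integral>\<^sup>+\<omega>. e2ennreal (Y \<omega>) \<partial>M) < \<infinity> \<or> (\<integral>\<^sup>+\<omega>. e2ennreal (- Y \<omega>) \<partial>M) < \<infinity>)"

definition avar :: "real \<Rightarrow> 'a measure \<Rightarrow> ('a \<Rightarrow> ereal) \<Rightarrow> ereal" where
  "avar \<alpha> M Y =
     (INF c::real. ereal c + ereal (1 / (1 - \<alpha>)) * expect M (\<lambda>\<omega>. max 0 (Y \<omega> - ereal c)))"

definition dual_densities :: "(real \<Rightarrow> real) \<Rightarrow> 'a measure \<Rightarrow> ('a \<Rightarrow> real) set" where
  "dual_densities \<sigma> M = {\<zeta> \<in> borel_measurable M.
     (\<forall>\<omega>\<in>space M. 0 \<le> \<zeta> \<omega>) \<and> expect M (\<lambda>\<omega>. ereal (\<zeta> \<omega>)) = 1 \<and>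
     (\<forall>\<alpha>\<in>{0<..<1}. avar \<alpha> M (\<lambda>\<omega>. ereal (\<zeta> \<omega>))
        \<le> ereal (1 / (1 - \<alpha>) * (LINT u:{\<alpha>..<1}|lborel. \<sigma> u)))}"

definition distortion_risk :: "(real \<Rightarrow> real) \<Rightarrow> 'a measure \<Rightarrow> ('a \<Rightarrow> ereal) \<Rightarrow> ereal" where
  "distortion_risk \<sigma> M Y = (SUP \<zeta>\<in>dual_densities \<sigma> M. expect M (\<lambda>\<omega>. Y \<omega> * ereal (\<zeta> \<omega>)))"


subsection \<open>Paths, filtration, and conditional probabilities\<close>

definition path_algebra ::
    "(nat \<Rightarrow> 'a topology) \<Rightarrow> nat set \<Rightarrow> (nat \<Rightarrow> 'a) measure" where
  "path_algebra X I = borel_of (product_topology X I)"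

definition paths :: "nat \<Rightarrow> (nat \<Rightarrow> 'a topology) \<Rightarrow> (nat \<Rightarrow> 'a) set" where
  "paths T X = topspace (product_topology X {1..T})"

definition natural_filtration ::
    "nat \<Rightarrow> (nat \<Rightarrow> 'a topology) \<Rightarrow> nat \<Rightarrow> (nat \<Rightarrow> 'a) measure" where
  "natural_filtration T X t =
     vimage_algebra (paths T X) (\<lambda>x. restrict x {1..t}) (path_algebra X {1..t})"

text \<open>\<open>\<kappa> w\<close> is the conditional law of \<open>x\<^sub>t\<^sub>+\<^sub>1\<^sub>:\<^sub>T\<close> given \<open>x\<^sub>1\<^sub>:\<^sub>t = w\<close>; any version is admitted.\<close>

definition regular_cond_prob ::
    "nat \<Rightarrow> (nat \<Rightarrow> 'a topology) \<Rightarrow> (nat \<Rightarrow> 'a) measure \<Rightarrow> nat \<Rightarrow>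
     ((nat \<Rightarrow> 'a) \<Rightarrow> (nat \<Rightarrow> 'a) measure) \<Rightarrow> bool" where
  "regular_cond_prob T X P t \<kappa> \<longleftrightarrow>
     \<kappa> \<in> path_algebra X {1..t} \<rightarrow>\<^sub>M prob_algebra (path_algebra X {Suc t..T}) \<and>
     (\<forall>A\<in>sets (path_algebra X {1..t}). \<forall>B\<in>sets (path_algebra X {Suc t..T}).
        emeasure P {x \<in> space P. restrict x {1..t} \<in> A \<and> restrict x {Suc t..T} \<in> B} =
        (\<integral>\<^sup>+x. indicator A (restrict x {1..t}) * emeasure (\<kappa> (restrict x {1..t})) B \<partial>P))"


subsection \<open>Nested risk functionals\<close>

text \<open>
  \<open>cond_risk T \<kappa> S t Y x\<close> is \<open>\<R>\<^bsub>S(t+1)\<^esub>(Y | x\<^sub>1\<^sub>:\<^sub>t)\<close>. It reads only the coordinates \<open>1, \<dots>, t\<close> of \<open>x\<close>;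
  \<open>merge\<close> forms the path \<open>(x\<^sub>1\<^sub>:\<^sub>t, y)\<close>. Random variables are functions of the whole path, so the
  result can be fed to the next conditional risk measure. \<open>nested_risk T \<kappa> S s t\<close> composes the
  conditional risk measures given \<open>x\<^sub>1\<^sub>:\<^sub>s\<close> (outermost), \<open>\<dots>\<close>, \<open>x\<^sub>1\<^sub>:\<^sub>t\<^sub>-\<^sub>1\<close> (innermost), and is the
  identity for \<open>s = t\<close>.
\<close>

definition cond_risk ::
    "nat \<Rightarrow> (nat \<Rightarrow> (nat \<Rightarrow> 'a) \<Rightarrow> (nat \<Rightarrow> 'a) measure) \<Rightarrow> (nat \<Rightarrow> (real \<Rightarrow> real) set) \<Rightarrow>
     nat \<Rightarrow> ((nat \<Rightarrow> 'a) \<Rightarrow> ereal) \<Rightarrow> (nat \<Rightarrow> 'a) \<Rightarrow> ereal" where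
  "cond_risk T \<kappa> S t Y x =
     (SUP \<sigma>\<in>S (Suc t). distortion_risk \<sigma> (\<kappa> t (restrict x {1..t}))
        (\<lambda>y. Y (merge {1..t} {Suc t..T} (x, y))))"

definition nested_risk ::
    "nat \<Rightarrow> (nat \<Rightarrow> (nat \<Rightarrow> 'a) \<Rightarrow> (nat \<Rightarrow> 'a) measure) \<Rightarrow> (nat \<Rightarrow> (real \<Rightarrow> real) set) \<Rightarrow>
     nat \<Rightarrow> nat \<Rightarrow> ((nat \<Rightarrow> 'a) \<Rightarrow> ereal) \<Rightarrow> (nat \<Rightarrow> 'a) \<Rightarrow> ereal" where
  "nested_risk T \<kappa> S s t Y = foldr (cond_risk T \<kappa> S) [s..<t] Y"

definition total_risk ::
    "nat \<Rightarrow> (nat \<Rightarrow> (nat \<Rightarrow> 'a) \<Rightarrow> (nat \<Rightarrow> 'a) measure) \<Rightarrow> (nat \<Rightarrow> (real \<Rightarrow> real) set) \<Rightarrow>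
     ((nat \<Rightarrow> 'a) \<Rightarrow> ereal) \<Rightarrow> ereal" where
  "total_risk T \<kappa> S Y = nested_risk T \<kappa> S 0 T Y (\<lambda>_. undefined)"

text \<open>
  All intermediate risks are random variables, and no expectation occurring in a conditional risk
  measure is of the form \<open>\<infinity> - \<infinity>\<close>, up to null sets of paths.
\<close>

definition nested_risk_well_defined ::
    "nat \<Rightarrow> (nat \<Rightarrow> 'a topology) \<Rightarrow> (nat \<Rightarrow> 'a) measure \<Rightarrow>
     (nat \<Rightarrow> (nat \<Rightarrow> 'a) \<Rightarrow> (nat \<Rightarrow> 'a) measure) \<Rightarrow> (nat \<Rightarrow> (real \<Rightarrow> real) set) \<Rightarrow>
     ((nat \<Rightarrow> 'a) \<Rightarrow> ereal) \<Rightarrow> bool" where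
  "nested_risk_well_defined T X P \<kappa> S Y \<longleftrightarrow>
     (\<forall>t\<in>{0..T}. nested_risk T \<kappa> S t T Y \<in> borel_measurable (natural_filtration T X t)) \<and>
     (\<forall>t\<in>{0..<T}. AE x in P. \<forall>\<sigma>\<in>S (Suc t). \<forall>\<zeta>\<in>dual_densities \<sigma> (\<kappa> t (restrict x {1..t})).
        quasi_integrable (\<kappa> t (restrict x {1..t}))
          (\<lambda>y. nested_risk T \<kappa> S (Suc t) T Y (merge {1..t} {Suc t..T} (x, y)) * ereal (\<zeta> y)))"

text \<open>
  A process adapted to the natural filtration for which \<open>v\<^sub>t\<close> is a.s. the conditional risk of
  \<open>v\<^sub>t\<^sub>+\<^sub>1\<close>. Adaptedness expresses \<open>v\<^sub>t = v\<^sub>t(x\<^sub>1\<^sub>:\<^sub>t)\<close>.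
\<close>

definition risk_martingale ::
    "nat \<Rightarrow> (nat \<Rightarrow> 'a topology) \<Rightarrow> (nat \<Rightarrow> 'a) measure \<Rightarrow>
     (nat \<Rightarrow> (nat \<Rightarrow> 'a) \<Rightarrow> (nat \<Rightarrow> 'a) measure) \<Rightarrow> (nat \<Rightarrow> (real \<Rightarrow> real) set) \<Rightarrow>
     (nat \<Rightarrow> (nat \<Rightarrow> 'a) \<Rightarrow> ereal) \<Rightarrow> bool" where
  "risk_martingale T X P \<kappa> S v \<longleftrightarrow>
     (\<forall>t\<in>{0..T}. v t \<in> borel_measurable (natural_filtration T X t)) \<and>
     (\<forall>t\<in>{0..<T}. AE x in P. v t x = cond_risk T \<kappa> S t (v (Suc t)) x)"


subsection \<open>Policies and the optimization problem\<close>

text \<open>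
  The second condition spells out \<open>z\<^sub>t = z\<^sub>t(x\<^sub>1\<^sub>:\<^sub>t)\<close>. It follows from the first one as soon as points
  of the decision spaces are closed; no separation axiom is imposed on \<open>Z\<close> here.
\<close>

definition adapted_policies ::
    "nat \<Rightarrow> (nat \<Rightarrow> 'a topology) \<Rightarrow> (nat \<Rightarrow> 'z topology) \<Rightarrow> (nat \<Rightarrow> (nat \<Rightarrow> 'a) \<Rightarrow> 'z) set" where
  "adapted_policies T X Z = {z. \<forall>t\<in>{0..T}.
     z t \<in> natural_filtration T X t \<rightarrow>\<^sub>M borel_of (Z t) \<and>
     (\<forall>x\<in>paths T X. \<forall>x'\<in>paths T X. restrict x {1..t} = restrict x' {1..t} \<longrightarrow> z t x = z t x')}"

definition policy_cost ::
    "nat \<Rightarrow> ((nat \<Rightarrow> 'z) \<Rightarrow> (nat \<Rightarrow> 'a) \<Rightarrow> ereal) \<Rightarrow> (nat \<Rightarrow> (nat \<Rightarrow> 'a) \<Rightarrow> 'z) \<Rightarrow>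
     (nat \<Rightarrow> 'a) \<Rightarrow> ereal" where
  "policy_cost T Q z x = Q (\<lambda>s\<in>{0..T}. z s x) x"

definition optimal_value ::
    "nat \<Rightarrow> (nat \<Rightarrow> 'a topology) \<Rightarrow> (nat \<Rightarrow> (nat \<Rightarrow> 'a) \<Rightarrow> (nat \<Rightarrow> 'a) measure) \<Rightarrow>
     (nat \<Rightarrow> (real \<Rightarrow> real) set) \<Rightarrow> (nat \<Rightarrow> 'z topology) \<Rightarrow>
     ((nat \<Rightarrow> 'z) \<Rightarrow> (nat \<Rightarrow> 'a) \<Rightarrow> ereal) \<Rightarrow> ereal" where
  "optimal_value T X \<kappa> S Z Q = (INF z\<in>adapted_policies T X Z. total_risk T \<kappa> S (policy_cost T Q z))"

definition optimal_policy ::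
    "nat \<Rightarrow> (nat \<Rightarrow> 'a topology) \<Rightarrow> (nat \<Rightarrow> (nat \<Rightarrow> 'a) \<Rightarrow> (nat \<Rightarrow> 'a) measure) \<Rightarrow>
     (nat \<Rightarrow> (real \<Rightarrow> real) set) \<Rightarrow> (nat \<Rightarrow> 'z topology) \<Rightarrow>
     ((nat \<Rightarrow> 'z) \<Rightarrow> (nat \<Rightarrow> 'a) \<Rightarrow> ereal) \<Rightarrow> (nat \<Rightarrow> (nat \<Rightarrow> 'a) \<Rightarrow> 'z) \<Rightarrow> bool" where
  "optimal_policy T X \<kappa> S Z Q z \<longleftrightarrow> z \<in> adapted_policies T X Z \<and>
     total_risk T \<kappa> S (policy_cost T Q z) = optimal_value T X \<kappa> S Z Q"

text \<open>The decisions \<open>z\<^sub>0, \<dots>, z\<^sub>t\<close> are frozen at the path \<open>x\<close>, the later ones react to the remaining path.\<close>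

definition value_process ::
    "nat \<Rightarrow> (nat \<Rightarrow> (nat \<Rightarrow> 'a) \<Rightarrow> (nat \<Rightarrow> 'a) measure) \<Rightarrow> (nat \<Rightarrow> (real \<Rightarrow> real) set) \<Rightarrow>
     ((nat \<Rightarrow> 'z) \<Rightarrow> (nat \<Rightarrow> 'a) \<Rightarrow> ereal) \<Rightarrow> (nat \<Rightarrow> (nat \<Rightarrow> 'a) \<Rightarrow> 'z) \<Rightarrow>
     nat \<Rightarrow> (nat \<Rightarrow> 'a) \<Rightarrow> ereal" where
  "value_process T \<kappa> S Q z t x =
     nested_risk T \<kappa> S t T (\<lambda>x'. Q (\<lambda>s\<in>{0..T}. if s \<le> t then z s x else z s x') x') x"

end

theory Submission
  imports Defs
begin

text \<open>
  The conditional risk given \<open>x\<^sub>1\<^sub>:\<^sub>t\<close> integrates \<open>Y\<close> only over paths that continue \<open>x\<^sub>1\<^sub>:\<^sub>t\<close>, because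
  \<open>\<kappa> t\<close> lives on the remaining coordinates. Each further conditional risk in the nesting starts from
  such a continuation and passes to longer ones, so the whole nested risk at \<open>x\<close> sees \<open>Y\<close> only on
  continuations of \<open>x\<^sub>1\<^sub>:\<^sub>t\<close> (\<open>nested_risk_local\<close>).

  On these continuations an adapted policy takes the same decisions up to time \<open>t\<close> as on \<open>x\<close>.
  Freezing \<open>z\<^sub>0, \<dots>, z\<^sub>t\<close> at \<open>x\<close> therefore changes nothing, and the value process is the process of nested
  risks of the one random cost \<open>policy_cost T Q z\<close> (\<open>value_process_eq_nested_risk\<close>). The nested
  risks satisfy the martingale identity by construction, since \<open>\<R>\<^bsub>S(t+1:T)\<^esub>\<close> is \<open>\<R>\<^bsub>S(t+1)\<^esub>\<close> applied to
  \<open>\<R>\<^bsub>S(t+2:T)\<^esub>\<close>. At time 0 there is nothing to condition on, and the nested risk is the total risk of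
  the policy, which optimality identifies with the infimum. Adaptedness of the value process is the
  measurability of the nested risks that is part of their being well defined.
\<close>

lemma space_borel_of: "space (borel_of X) = topspace X"
  unfolding borel_of_def by (rule space_measure_of) (auto dest: openin_subset)

lemma space_natural_filtration: "space (natural_filtration T X t) = paths T X"
  by (simp add: natural_filtration_def)

lemma expect_cong:
  assumes "\<And>\<omega>. \<omega> \<in> space M \<Longrightarrow> Y \<omega> = Y' \<omega>"
  shows "expect M Y = expect M Y'"
  unfolding expect_def using assms by (simp cong: nn_integral_cong_simp)

lemma distortion_risk_cong:
  assumes "\<And>\<omega>. \<omega> \<in> space M \<Longrightarrow> Y \<omega> = Y' \<omega>"
  shows "distortion_risk \<sigma> M Y = distortion_risk \<sigma> M Y'"
  unfolding distortion_risk_def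
  by (intro SUP_cong refl expect_cong) (simp add: assms)

lemma space_regular_cond_prob:
  assumes "regular_cond_prob T X P t \<kappa>" "t \<le> T" "x \<in> paths T X"
  shows "space (\<kappa> (restrict x {1..t})) = topspace (product_topology X {Suc t..T})"
proof -
  have x: "x \<in> (\<Pi>\<^sub>E i\<in>{1..T}. topspace (X i))"
    using assms(3) unfolding paths_def topspace_product_topology .
  have "\<forall>i\<in>{1..t}. x i \<in> topspace (X i)"
  proof
    fix i assume "i \<in> {1..t}"
    then have "i \<in> {1..T}"
      using assms(2) by simp
    with x show "x i \<in> topspace (X i)"
      by (rule PiE_mem)
  qed
  then have "restrict x {1..t} \<in> space (path_algebra X {1..t})"
    unfolding path_algebra_def space_borel_of topspace_product_topology restrict_PiE_iff .
  moreover have "\<kappa> \<in> path_algebra X {1..t} \<rightarrow>\<^sub>M prob_algebra (path_algebra X {Suc t..T})"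
    using assms(1) unfolding regular_cond_prob_def by (rule conjunct1)
  ultimately have "\<kappa> (restrict x {1..t}) \<in> space (prob_algebra (path_algebra X {Suc t..T}))"
    by (simp only: measurable_space)
  then have "sets (\<kappa> (restrict x {1..t})) = sets (path_algebra X {Suc t..T})"
    by (simp add: space_prob_algebra)
  from sets_eq_imp_space_eq[OF this] show ?thesis
    by (simp add: path_algebra_def space_borel_of)
qed

lemma merge_in_paths:
  assumes "x \<in> paths T X" "y \<in> topspace (product_topology X {Suc t..T})" "t \<le> T"
  shows "merge {1..t} {Suc t..T} (x, y) \<in> paths T X"
  using assms unfolding paths_def topspace_product_topology
  by (intro PiE_I) (auto simp: merge_def PiE_mem not_le Suc_le_eq)

lemma restrict_merge_prefix:
  "restrict (merge {1..t} I (x, y)) {1..t} = restrict x {1..t}"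
  by (rule ext) (simp add: merge_def)

text \<open>
  The conditional law given \<open>x\<^sub>1\<^sub>:\<^sub>t\<close> charges only tails \<open>y\<close>, and every \<open>(x\<^sub>1\<^sub>:\<^sub>t, y)\<close> is a path that
  continues \<open>x\<^sub>1\<^sub>:\<^sub>t\<close>. The set of dual densities depends on the law alone.
\<close>

lemma cond_risk_local:
  assumes "regular_cond_prob T X P t (\<kappa> t)" "t \<le> T" "x \<in> paths T X"
    and "\<And>x'. x' \<in> paths T X \<Longrightarrow> restrict x' {1..t} = restrict x {1..t} \<Longrightarrow> Y x' = Y' x'"
  shows "cond_risk T \<kappa> S t Y x = cond_risk T \<kappa> S t Y' x"
  unfolding cond_risk_def
proof (intro SUP_cong refl distortion_risk_cong)
  fix y assume "y \<in> space (\<kappa> t (restrict x {1..t}))"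
  then have "y \<in> topspace (product_topology X {Suc t..T})"
    unfolding space_regular_cond_prob[OF assms(1-3)] .
  then have "merge {1..t} {Suc t..T} (x, y) \<in> paths T X"
    by (rule merge_in_paths[OF assms(3) _ assms(2)])
  then show "Y (merge {1..t} {Suc t..T} (x, y)) = Y' (merge {1..t} {Suc t..T} (x, y))"
    by (rule assms(4)) (rule restrict_merge_prefix)
qed

lemma nested_risk_refl: "nested_risk T \<kappa> S t t Y = Y"
  by (simp add: nested_risk_def)

lemma nested_risk_step:
  assumes "s < t"
  shows "nested_risk T \<kappa> S s t Y = cond_risk T \<kappa> S s (nested_risk T \<kappa> S (Suc s) t Y)"
  using assms by (simp add: nested_risk_def upt_conv_Cons)

lemma restrict_eq_prefix:
  fixes s t :: nat
  assumes "restrict x {1..t} = restrict x' {1..t}" "s \<le> t"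
  shows "restrict x {1..s} = restrict x' {1..s}"
proof (rule ext)
  fix i
  show "restrict x {1..s} i = restrict x' {1..s} i"
  proof (cases "i \<in> {1..s}")
    case True
    then have "i \<in> {1..t}"
      using assms(2) by simp
    then have "x i = x' i"
      using fun_cong[OF assms(1), of i] by (simp only: restrict_apply if_True)
    then show ?thesis
      by (simp only: restrict_apply)
  qed (simp only: restrict_apply if_False)
qed

text \<open>
  A continuation of a continuation of \<open>x\<^sub>1\<^sub>:\<^sub>t\<close> is again a continuation of \<open>x\<^sub>1\<^sub>:\<^sub>t\<close>, so locality passes
  from the innermost conditional risk outwards.
\<close>

lemma nested_risk_local:
  assumes \<kappa>: "\<forall>t\<in>{0..<T}. regular_cond_prob T X P t (\<kappa> t)"
    and "t \<le> T" "x \<in> paths T X"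
    and "\<And>x'. x' \<in> paths T X \<Longrightarrow> restrict x' {1..t} = restrict x {1..t} \<Longrightarrow> Y x' = Y' x'"
  shows "nested_risk T \<kappa> S t T Y x = nested_risk T \<kappa> S t T Y' x"
  using assms(2-)
proof (induction t arbitrary: x rule: inc_induct)
  case base
  then show ?case
    by (simp add: nested_risk_refl)
next
  case (step s)
  have "cond_risk T \<kappa> S s (nested_risk T \<kappa> S (Suc s) T Y) x =
        cond_risk T \<kappa> S s (nested_risk T \<kappa> S (Suc s) T Y') x"
  proof (rule cond_risk_local)
    show "regular_cond_prob T X P s (\<kappa> s)" "s \<le> T" "x \<in> paths T X"
      using \<kappa> step by auto
    fix x' assume x': "x' \<in> paths T X" "restrict x' {1..s} = restrict x {1..s}"
    show "nested_risk T \<kappa> S (Suc s) T Y x' = nested_risk T \<kappa> S (Suc s) T Y' x'"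
    proof (rule step.IH[OF x'(1)])
      fix x'' assume x'': "x'' \<in> paths T X" "restrict x'' {1..Suc s} = restrict x' {1..Suc s}"
      have "restrict x'' {1..s} = restrict x {1..s}"
        using restrict_eq_prefix[OF x''(2), of s] x'(2) by simp
      then show "Y x'' = Y' x''"
        by (rule step.prems(2)[OF x''(1)])
    qed
  qed
  then show ?case
    using step.hyps by (simp add: nested_risk_step)
qed

text \<open>
  The cost with frozen early decisions is a different random variable for every \<open>x\<close>, but on the
  continuations of \<open>x\<^sub>1\<^sub>:\<^sub>t\<close> it agrees with the cost of the policy.
\<close>

lemma value_process_eq_nested_risk:
  assumes "\<forall>t\<in>{0..<T}. regular_cond_prob T X P t (\<kappa> t)"
    and z: "z \<in> adapted_policies T X Z"
    and t: "t \<le> T" and x: "x \<in> paths T X"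
  shows "value_process T \<kappa> S Q z t x = nested_risk T \<kappa> S t T (policy_cost T Q z) x"
  unfolding value_process_def
proof (rule nested_risk_local[OF assms(1) t x])
  fix x' assume x': "x' \<in> paths T X" "restrict x' {1..t} = restrict x {1..t}"
  have "z s x = z s x'" if "s \<le> t" for s
  proof -
    have "restrict x {1..s} = restrict x' {1..s}"
      using restrict_eq_prefix[OF x'(2) that] by simp
    moreover have "s \<in> {0..T}"
      using that t by simp
    ultimately show ?thesis
      using z x x'(1) unfolding adapted_policies_def by blast
  qed
  then have "(\<lambda>s\<in>{0..T}. if s \<le> t then z s x else z s x') = (\<lambda>s\<in>{0..T}. z s x')"
    by (auto simp: restrict_def)
  then show "Q (\<lambda>s\<in>{0..T}. if s \<le> t then z s x else z s x') x' = policy_cost T Q z x'"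
    by (simp add: policy_cost_def)
qed

text \<open>
  Conditioning on the empty tuple reads no coordinate of the path, so the nested risk at time 0 may
  be evaluated at any point, even at one that is not a path. For \<open>T = 0\<close> this would fail, because
  the nested risk is then \<open>Y\<close> itself.
\<close>

lemma nested_risk_0_eq_total_risk:
  assumes "T \<ge> 1"
  shows "nested_risk T \<kappa> S 0 T Y x = total_risk T \<kappa> S Y"
proof -
  have "cond_risk T \<kappa> S 0 Y' x = cond_risk T \<kappa> S 0 Y' (\<lambda>_. undefined)" for Y'
    by (simp add: cond_risk_def merge_def restrict_def)
  then show ?thesis
    using assms by (simp add: total_risk_def nested_risk_step)
qed

theorem corollary43:
  fixes T :: nat
    and X :: "nat \<Rightarrow> 'a topology"
    and P :: "(nat \<Rightarrow> 'a) measure"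
    and \<kappa> :: "nat \<Rightarrow> (nat \<Rightarrow> 'a) \<Rightarrow> (nat \<Rightarrow> 'a) measure"
    and S :: "nat \<Rightarrow> (real \<Rightarrow> real) set"
    and Z :: "nat \<Rightarrow> 'z topology"
    and Q :: "(nat \<Rightarrow> 'z) \<Rightarrow> (nat \<Rightarrow> 'a) \<Rightarrow> ereal"
    and z :: "nat \<Rightarrow> (nat \<Rightarrow> 'a) \<Rightarrow> 'z"
  assumes "T \<ge> 1"
    and "\<forall>t\<in>{1..T}. polish_topology (X t)"
    and "prob_space P" and "sets P = sets (borel_of (product_topology X {1..T}))"
    and "\<forall>t\<in>{0..<T}. regular_cond_prob T X P t (\<kappa> t)"
    and "\<forall>t\<in>{1..T}. \<forall>\<sigma>\<in>S t. distortion_function \<sigma>"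
    and "\<forall>d\<in>topspace (product_topology Z {0..T}). \<forall>x\<in>topspace (product_topology X {1..T}).
           Q d x \<noteq> -\<infinity>"
    and "lsc_on (prod_topology (product_topology Z {0..T}) (product_topology X {1..T}))
           (\<lambda>(d, x). Q d x)"
    and "\<forall>z'\<in>adapted_policies T X Z. nested_risk_well_defined T X P \<kappa> S (policy_cost T Q z')"
    and "optimal_policy T X \<kappa> S Z Q z"
  shows "risk_martingale T X P \<kappa> S (value_process T \<kappa> S Q z) \<and>
         (\<forall>x\<in>paths T X. value_process T \<kappa> S Q z 0 x = optimal_value T X \<kappa> S Z Q)"
proof
  note regular = assms(5)
  have adapted: "z \<in> adapted_policies T X Z"
    using assms(10) by (simp add: optimal_policy_def)
  then have well_defined: "nested_risk_well_defined T X P \<kappa> S (policy_cost T Q z)"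
    using assms(9) by blast
  note value_eq = value_process_eq_nested_risk[OF regular adapted]
  have space_P: "space P = paths T X"
    using sets_eq_imp_space_eq[OF assms(4)] by (simp add: space_borel_of paths_def)
  show "risk_martingale T X P \<kappa> S (value_process T \<kappa> S Q z)"
    unfolding risk_martingale_def
  proof (intro conjI ballI)
    fix t assume t: "t \<in> {0..T}"
    have "nested_risk T \<kappa> S t T (policy_cost T Q z) \<in> borel_measurable (natural_filtration T X t)"
      using well_defined t unfolding nested_risk_well_defined_def by blast
    also have "?this \<longleftrightarrow>
        value_process T \<kappa> S Q z t \<in> borel_measurable (natural_filtration T X t)"
      by (rule measurable_cong) (use t in \<open>simp add: space_natural_filtration value_eq\<close>)
    finally show "value_process T \<kappa> S Q z t \<in> borel_measurable (natural_filtration T X t)" .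
  next
    fix t assume "t \<in> {0..<T}"
    then have t: "t < T" "regular_cond_prob T X P t (\<kappa> t)"
      using regular by auto
    show "AE x in P. value_process T \<kappa> S Q z t x =
        cond_risk T \<kappa> S t (value_process T \<kappa> S Q z (Suc t)) x"
    proof (rule AE_I2)
      fix x assume "x \<in> space P"
      then have x: "x \<in> paths T X"
        by (simp add: space_P)
      have "value_process T \<kappa> S Q z t x =
          cond_risk T \<kappa> S t (nested_risk T \<kappa> S (Suc t) T (policy_cost T Q z)) x"
        using t x by (simp add: value_eq nested_risk_step)
      also have "\<dots> = cond_risk T \<kappa> S t (value_process T \<kappa> S Q z (Suc t)) x"
        by (rule cond_risk_local[where X = X and P = P]) (use t x in \<open>auto simp: value_eq\<close>)
      finally show "value_process T \<kappa> S Q z t x =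
          cond_risk T \<kappa> S t (value_process T \<kappa> S Q z (Suc t)) x" .
    qed
  qed
  show "\<forall>x\<in>paths T X. value_process T \<kappa> S Q z 0 x = optimal_value T X \<kappa> S Z Q"
    using assms(10)
    by (simp add: value_eq nested_risk_0_eq_total_risk[OF assms(1)] optimal_policy_def)
qed

end
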